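(* Assume that $A_0^i$ and $A_{22}^i$ are Hurwitz for all $i\in\mathcal I$, and let $\gamma_{11}=1$ and $\gamma_{12}=0$. Then there exist $\varepsilon_3^*>0$ and a function $\eta_3:(0,\varepsilon_3^* )\to[0,\infty)$ with $\eta_3(\varepsilon)=\mathcal O(\varepsilon)$ such that for all $\varepsilon\in(0,\varepsilon_3^* )$, for all sequences $(t_k)_{k\ge 0}$ of event times satisfying, for some $\tau^*$ with $\tau^*>\eta_3(\varepsilon)$, the dwell-time property $\tau_k:=t_{k+1}-t_k\ge\tau^*$ for all $k\in\mathbb N$, and for all sequences $(\sigma_k)_{k\ge0}$ in $\mathcal I$ and $(\nu_k)_{k\ge1}$ in $\mathcal J$, the singularly perturbed hybrid system (H) is globally asymptotically stable.
   Context: Setting. Let $n_x,n_z\ge1$, $n=n_x+n_z$, let $\varepsilon>0$ be a parameter and $\mathcal I,\mathcal J$ finite nonempty index sets. For each $i\in\mathcal I$, $\mathbf D^i$ is an $n\times n$ diagonal matrix with $n_z$ diagonal entries equal to $\varepsilon$ and the other $n_x$ equal to $1$ (positions may depend on $i$), and $S_i$ is a permutation matrix with $S_i\mathbf D^iS_i^\top=\mathrm{diag}(I_{n_x},\varepsilon I_{n_z})$. Let $\mathbf A^i\in\mathbb R^{n\times n}$ ($i\in\mathcal I$) and $\mathbf J^j\in\mathbb R^{n\times n}$ ($j\in\mathcal J$) be given (independent of $\varepsilon$), and set $A^i=S_i\mathbf A^iS_i^\top$, $J^{i\stackrel{j}{\to}i'}=S_{i'}\mathbf J^jS_i^\top$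 for $i,i'\in\mathcal I$, $j\in\mathcal J$. Write in blocks of sizes $n_x,n_z$: $$A^i=\begin{pmatrix} A^i_{11} & A^i_{12} \\ A^i_{21} & A^i_{22} \end{pmatrix},$$ with $A_{22}^i$ non-singular. Set $A_0^i=A_{11}^i-A_{12}^i(A_{22}^i)^{-1}A_{21}^i$, $B_1^i=A_{12}^i$, $B_2^i=(A_{22}^i)^{-1}A_{21}^iA_0^i$, $B_3^i=(A_{22}^i)^{-1}A_{21}^iA_{12}^i$, $$P_i=\begin{pmatrix} I_{n_x} & 0 \\ (A_{22}^i)^{-1}A_{21}^i & I_{n_z} \end{pmatrix},\qquad R^{i\stackrel{j}{\to}i'}=P_{i'}J^{i\stackrel{j}{\to}i'}P_i^{-1}=\begin{pmatrix} R_{11}^{i\stackrel{j}{\to}i'} & R_{12}^{i\stackrel{j}{\to}i'} \\ R_{21}^{i\stackrel{j}{\to}i'} & R_{22}^{i\stackrel{j}{\to}i'} \end{pmatrix}.$$ A sequence of event times is a strictly increasing unbounded sequence $0=t_0<t_1<\cdots$. Given such a sequence, modes $\sigma_k\in\mathcal I$ ($k\ge0$) and $\nu_k\in\mathcal J$ ($k\ge1$), system (H) with state $(x(t),y(t))\in\mathbb R^{n_x}\times\mathbb R^{n_z}$ is, for $t\in[t_k,t_{k+1})$, $k\in\mathbb N$, $$\dot x=A_0^{\sigma_k}x+B_1^{\sigma_k}y,\qquad \varepsilon\dot y=\varepsilon B_2^{\sigma_k}x+(A_{22}^{\sigma_k}+\varepsilon B_3^{\sigma_k})y,$$ and, for $k\ge1$,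 $\begin{pmatrix} x(t_k) \\ y(t_k) \end{pmatrix}=R^{\sigma_{k-1}\stackrel{\nu_k}{\to}\sigma_k}\begin{pmatrix} x(t_k^-) \\ y(t_k^-) \end{pmatrix}$, where $t_k^-$ denotes the left limit. Globally asymptotically stable means: the origin is Lyapunov stable (for every $\rho>0$ there is $\delta>0$ such that initial states at time $0$ of norm $<\delta$ give solutions of norm $<\rho$ for all $t\ge0$) and every solution tends to $0$ as $t\to\infty$. Constants. Since $A_0^i,A_{22}^i$ are Hurwitz, fix symmetric matrices $Q_s^i\ge I_{n_x}$, $Q_f^i\ge I_{n_z}$ and numbers $\lambda_s^i,\lambda_f^i>0$ with $A_0^{i\top}Q_s^i+Q_s^iA_0^i\le-2\lambda_s^iQ_s^i$ and $A_{22}^{i\top}Q_f^i+Q_f^iA_{22}^i\le-2\lambda_f^iQ_f^i$ for all $i\in\mathcal I$. With $\|\cdot\|$ the spectral norm and maxima over $i,i'\in\mathcal I$, $j\in\mathcal J$, put $$\gamma_{11}=\max\|(Q_s^{i'})^{1/2}R_{11}^{i\stackrel{j}{\to}i'}(Q_s^i)^{-1/2}\|,\qquad \gamma_{12}=\max\|(Q_s^{i'})^{1/2}R_{12}^{i\stackrel{j}{\to}i'}(Q_f^i)^{-1/2}\|.$$ $\eta(\varepsilon)=\mathcal O(\varepsilon)$ for a function $\eta$ on $(0,\varepsilon^* )$ means: there are $\varepsilon_0\in(0,\varepsilon^* )$ and $c>0$ with $|\eta(\varepsilon)|\le c\varepsilon$ for all $\varepsilon\in(0,\varepsilon_0)$.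 *)

theory Defs
  imports "HOL-Analysis.Analysis"
begin

text \<open>
  The coordinates $1,\dots,n$ with $n = n_x + n_z$ are the elements of the sum type
  \<^typ>\<open>'x + 'z\<close>, where \<^term>\<open>CARD('x::finite)\<close> and \<^term>\<open>CARD('z::finite)\<close> play the roles of
  $n_x$ and $n_z$; the left summand carries the slow block.
\<close>

subsection \<open>Block matrices\<close>

definition block11 :: "real ^ ('x::finite + 'z::finite) ^ ('x + 'z) \<Rightarrow> real ^ 'x ^ 'x"
  where "block11 M = (\<chi> i j. M $ Inl i $ Inl j)"

definition block12 :: "real ^ ('x::finite + 'z::finite) ^ ('x + 'z) \<Rightarrow> real ^ 'z ^ 'x"
  where "block12 M = (\<chi> i j. M $ Inl i $ Inr j)"

definition block21 :: "real ^ ('x::finite + 'z::finite) ^ ('x + 'z) \<Rightarrow> real ^ 'x ^ 'z"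
  where "block21 M = (\<chi> i j. M $ Inr i $ Inl j)"

definition block22 :: "real ^ ('x::finite + 'z::finite) ^ ('x + 'z) \<Rightarrow> real ^ 'z ^ 'z"
  where "block22 M = (\<chi> i j. M $ Inr i $ Inr j)"

definition block_mat ::
  "real ^ 'x ^ 'x \<Rightarrow> real ^ 'z ^ 'x \<Rightarrow> real ^ 'x ^ 'z \<Rightarrow> real ^ 'z ^ 'z
    \<Rightarrow> real ^ ('x::finite + 'z::finite) ^ ('x + 'z)"
  where "block_mat M11 M12 M21 M22 =
    (\<chi> k l. case k of
        Inl i \<Rightarrow> (case l of Inl j \<Rightarrow> M11 $ i $ j | Inr j \<Rightarrow> M12 $ i $ j)
      | Inr i \<Rightarrow> (case l of Inl j \<Rightarrow> M21 $ i $ j | Inr j \<Rightarrow> M22 $ i $ j))"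

definition block_vec :: "real ^ 'x \<Rightarrow> real ^ 'z \<Rightarrow> real ^ ('x::finite + 'z::finite)"
  where "block_vec x y = (\<chi> k. case k of Inl i \<Rightarrow> x $ i | Inr j \<Rightarrow> y $ j)"


subsection \<open>Matrix notions\<close>

text \<open>The diagonal matrix whose entries are \<open>\<epsilon>\<close> at the positions in \<open>Z\<close> and \<open>1\<close> elsewhere.\<close>

definition eps_diag :: "'n::finite set \<Rightarrow> real \<Rightarrow> real ^ 'n ^ 'n"
  where "eps_diag Z \<epsilon> = (\<chi> k l. if k = l then (if k \<in> Z then \<epsilon> else 1) else 0)"

definition permutation_mat :: "real ^ 'n ^ 'n::finite \<Rightarrow> bool"
  where "permutation_mat S \<longleftrightarrow> (\<exists>p. bij p \<and> S = (\<chi> k l. if l = p k then 1 else 0))"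

definition hurwitz :: "real ^ 'n ^ 'n::finite \<Rightarrow> bool"
  where "hurwitz M \<longleftrightarrow>
    (\<forall>(\<mu>::complex) (v::complex ^ 'n).
       v \<noteq> 0 \<and> map_matrix complex_of_real M *v v = \<mu> *s v \<longrightarrow> Re \<mu> < 0)"

definition symmetric_mat :: "real ^ 'n ^ 'n::finite \<Rightarrow> bool"
  where "symmetric_mat M \<longleftrightarrow> transpose M = M"

definition psd :: "real ^ 'n ^ 'n::finite \<Rightarrow> bool"
  where "psd M \<longleftrightarrow> symmetric_mat M \<and> (\<forall>v. 0 \<le> v \<bullet> (M *v v))"

definition loewner_le :: "real ^ 'n ^ 'n::finite \<Rightarrow> real ^ 'n ^ 'n \<Rightarrow> bool"
  where "loewner_le M N \<longleftrightarrow> psd (N - M)"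

text \<open>
  The principal square root; on a positive semidefinite argument the description denotes, since
  the positive semidefinite square root exists and is unique.
\<close>

definition psd_sqrt :: "real ^ 'n ^ 'n::finite \<Rightarrow> real ^ 'n ^ 'n"
  where "psd_sqrt Q = (THE S. psd S \<and> S ** S = Q)"

definition spectral_norm :: "real ^ 'm::finite ^ 'n::finite \<Rightarrow> real"
  where "spectral_norm M = onorm ((*v) M)"


subsection \<open>Reduced matrices of the modes and of the jumps\<close>

definition slow_A0 :: "real ^ ('x::finite + 'z::finite) ^ ('x + 'z) \<Rightarrow> real ^ 'x ^ 'x"
  where "slow_A0 A = block11 A - block12 A ** matrix_inv (block22 A) ** block21 A"

definition B1 :: "real ^ ('x::finite + 'z::finite) ^ ('x + 'z) \<Rightarrow> real ^ 'z ^ 'x"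
  where "B1 A = block12 A"

definition B2 :: "real ^ ('x::finite + 'z::finite) ^ ('x + 'z) \<Rightarrow> real ^ 'x ^ 'z"
  where "B2 A = matrix_inv (block22 A) ** block21 A ** slow_A0 A"

definition B3 :: "real ^ ('x::finite + 'z::finite) ^ ('x + 'z) \<Rightarrow> real ^ 'z ^ 'z"
  where "B3 A = matrix_inv (block22 A) ** block21 A ** block12 A"

definition P_mat ::
  "real ^ ('x::finite + 'z::finite) ^ ('x + 'z) \<Rightarrow> real ^ ('x + 'z) ^ ('x + 'z)"
  where "P_mat A = block_mat (mat 1) 0 (matrix_inv (block22 A) ** block21 A) (mat 1)"

text \<open>\<open>jump_R A J i j i'\<close> is the jump matrix from mode \<open>i\<close> to mode \<open>i'\<close> under the jump label \<open>j\<close>.\<close>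

definition jump_R ::
  "('i \<Rightarrow> real ^ ('x::finite + 'z::finite) ^ ('x + 'z))
    \<Rightarrow> ('i \<Rightarrow> 'j \<Rightarrow> 'i \<Rightarrow> real ^ ('x + 'z) ^ ('x + 'z))
    \<Rightarrow> 'i \<Rightarrow> 'j \<Rightarrow> 'i \<Rightarrow> real ^ ('x + 'z) ^ ('x + 'z)"
  where "jump_R A J i j i' = P_mat (A i') ** J i j i' ** matrix_inv (P_mat (A i))"

definition gamma11 ::
  "('i::finite \<Rightarrow> real ^ ('x::finite + 'z::finite) ^ ('x + 'z))
    \<Rightarrow> ('i \<Rightarrow> 'j::finite \<Rightarrow> 'i \<Rightarrow> real ^ ('x + 'z) ^ ('x + 'z))
    \<Rightarrow> ('i \<Rightarrow> real ^ 'x ^ 'x) \<Rightarrow> real"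
  where "gamma11 A J Qs =
    Max (range (\<lambda>(i, j, i').
      spectral_norm (psd_sqrt (Qs i') ** block11 (jump_R A J i j i') ** matrix_inv (psd_sqrt (Qs i)))))"

definition gamma12 ::
  "('i::finite \<Rightarrow> real ^ ('x::finite + 'z::finite) ^ ('x + 'z))
    \<Rightarrow> ('i \<Rightarrow> 'j::finite \<Rightarrow> 'i \<Rightarrow> real ^ ('x + 'z) ^ ('x + 'z))
    \<Rightarrow> ('i \<Rightarrow> real ^ 'x ^ 'x) \<Rightarrow> ('i \<Rightarrow> real ^ 'z ^ 'z) \<Rightarrow> real"
  where "gamma12 A J Qs Qf =
    Max (range (\<lambda>(i, j, i').
      spectral_norm (psd_sqrt (Qs i') ** block12 (jump_R A J i j i') ** matrix_inv (psd_sqrt (Qf i)))))"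


subsection \<open>The hybrid system\<close>

definition event_times :: "(nat \<Rightarrow> real) \<Rightarrow> bool"
  where "event_times t \<longleftrightarrow> t 0 = 0 \<and> strict_mono t \<and> \<not> bdd_above (range t)"

text \<open>
  The derivative within \<open>{t k..<t (Suc k)}\<close> is the right derivative at \<open>t k\<close> and the ordinary
  derivative at interior points. Only the values of \<open>x\<close> and \<open>y\<close> on $[0,\infty)$ and the values of
  \<open>\<nu>\<close> at positive indices matter.
\<close>

definition solution_H ::
  "real \<Rightarrow> ('i \<Rightarrow> real ^ ('x::finite + 'z::finite) ^ ('x + 'z))
    \<Rightarrow> ('i \<Rightarrow> 'j \<Rightarrow> 'i \<Rightarrow> real ^ ('x + 'z) ^ ('x + 'z))
    \<Rightarrow> (nat \<Rightarrow> real) \<Rightarrow> (nat \<Rightarrow> 'i) \<Rightarrow> (nat \<Rightarrow> 'j)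
    \<Rightarrow> (real \<Rightarrow> real ^ 'x) \<Rightarrow> (real \<Rightarrow> real ^ 'z) \<Rightarrow> bool"
  where "solution_H \<epsilon> A J t \<sigma> \<nu> x y \<longleftrightarrow>
    (\<forall>k. \<forall>s\<in>{t k..<t (Suc k)}. \<exists>x' y'.
        (x has_vector_derivative x') (at s within {t k..<t (Suc k)}) \<and>
        (y has_vector_derivative y') (at s within {t k..<t (Suc k)}) \<and>
        x' = slow_A0 (A (\<sigma> k)) *v x s + B1 (A (\<sigma> k)) *v y s \<and>
        \<epsilon> *\<^sub>R y' = \<epsilon> *\<^sub>R (B2 (A (\<sigma> k)) *v x s)
                   + (block22 (A (\<sigma> k)) + \<epsilon> *\<^sub>R B3 (A (\<sigma> k))) *v y s) \<and>
    (\<forall>k\<ge>1. \<exists>xl yl.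
        (x \<longlongrightarrow> xl) (at_left (t k)) \<and> (y \<longlongrightarrow> yl) (at_left (t k)) \<and>
        block_vec (x (t k)) (y (t k)) =
          jump_R A J (\<sigma> (k - 1)) (\<nu> k) (\<sigma> k) *v block_vec xl yl)"

definition globally_asymptotically_stable_H ::
  "real \<Rightarrow> ('i \<Rightarrow> real ^ ('x::finite + 'z::finite) ^ ('x + 'z))
    \<Rightarrow> ('i \<Rightarrow> 'j \<Rightarrow> 'i \<Rightarrow> real ^ ('x + 'z) ^ ('x + 'z))
    \<Rightarrow> (nat \<Rightarrow> real) \<Rightarrow> (nat \<Rightarrow> 'i) \<Rightarrow> (nat \<Rightarrow> 'j) \<Rightarrow> bool"
  where "globally_asymptotically_stable_H \<epsilon> A J t \<sigma> \<nu> \<longleftrightarrow>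
    (\<forall>\<rho>>0. \<exists>\<delta>>0. \<forall>x y. solution_H \<epsilon> A J t \<sigma> \<nu> x y \<and> norm (block_vec (x 0) (y 0)) < \<delta>
        \<longrightarrow> (\<forall>s\<ge>0. norm (block_vec (x s) (y s)) < \<rho>)) \<and>
    (\<forall>x y. solution_H \<epsilon> A J t \<sigma> \<nu> x y \<longrightarrow> ((\<lambda>s. block_vec (x s) (y s)) \<longlongrightarrow> 0) at_top)"

definition bigo_eps :: "(real \<Rightarrow> real) \<Rightarrow> real \<Rightarrow> bool"
  where "bigo_eps \<eta> \<epsilon>star \<longleftrightarrow>
    (\<exists>\<epsilon>0\<in>{0<..<\<epsilon>star}. \<exists>c>0. \<forall>\<epsilon>\<in>{0<..<\<epsilon>0}. \<bar>\<eta> \<epsilon>\<bar> \<le> c * \<epsilon>)"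

end

theory Submission
  imports Defs
begin

text \<open>
  On the interval \<open>[t\<^sub>k, t\<^sub>k\<^sub>+\<^sub>1)\<close> take \<open>V = x\<^sup>T Q\<^sub>s x + \<epsilon> \<kappa> \<phi>(s) y\<^sup>T Q\<^sub>f y\<close>, where the weight \<open>\<phi>\<close> grows linearly
  from \<open>1\<close> to \<open>g + 1\<close>. For \<open>\<kappa>\<close> large and \<open>\<epsilon>\<close> small, the fast decay of \<open>y\<close> at rate \<open>1 / \<epsilon>\<close> absorbs the
  coupling terms, and also the growth of \<open>\<phi>\<close> as soon as the dwell time is at least \<open>g \<epsilon> / l\<close>; hence
  \<open>V' \<le> - l V\<close>. At a jump the slow part does not increase (\<open>\<gamma>\<^sub>1\<^sub>1 = 1\<close>, \<open>\<gamma>\<^sub>1\<^sub>2 = 0\<close>), the new fast part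
  is at most \<open>g\<close> times the sum of both old parts, and the weight drops from \<open>g + 1\<close> back to \<open>1\<close>, so \<open>V\<close> grows at
  most by the factor \<open>1 + \<epsilon> \<kappa> g \<le> exp (\<epsilon> \<kappa> g)\<close>. A dwell time above \<open>\<kappa> g \<epsilon> / l\<close> therefore makes \<open>V\<close>
  contract by a fixed factor from each event to the next.
\<close>

section \<open>Symmetric matrices and the principal square root\<close>

lemma symmetric_mat_iff: "symmetric_mat M \<longleftrightarrow> (\<forall>u v. u \<bullet> (M *v v) = (M *v u) \<bullet> v)"
proof
  assume "symmetric_mat M"
  then show "\<forall>u v. u \<bullet> (M *v v) = (M *v u) \<bullet> v"
    by (metis dot_lmul_matrix symmetric_mat_def vector_transpose_matrix)
next
  assume *: "\<forall>u v. u \<bullet> (M *v v) = (M *v u) \<bullet> v"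
  have "M $ i $ j = M $ j $ i" for i j
  proof -
    have "axis i 1 \<bullet> (M *v axis j 1) = M $ i $ j" "(M *v axis i 1) \<bullet> axis j 1 = M $ j $ i"
      by (simp_all add: inner_axis inner_axis' matrix_vector_mul_component)
    with * show ?thesis by metis
  qed
  then show "symmetric_mat M"
    by (simp add: symmetric_mat_def transpose_def vec_eq_iff)
qed

text \<open>Serves to read signs off a trace: for positive semidefinite \<open>M\<close> every
  summand is nonnegative, so a zero trace makes each of them zero.\<close>

lemma trace_congruence:
  "trace (transpose X ** M ** X) = (\<Sum>i\<in>UNIV. column i X \<bullet> (M *v column i X))"
  for X M :: "real ^ 'n ^ 'n"
proof -
  have "(transpose X ** M ** X) $ i $ i = column i X \<bullet> (M *v column i X)" for i
    unfolding matrix_mul_assoc[symmetric]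
    by (simp add: matrix_matrix_mult_def transpose_def column_def inner_vec_def matrix_vector_mult_def)
  then show ?thesis by (simp add: trace_def)
qed

text \<open>The difference \<open>X = S - T\<close> solves the Sylvester equation \<open>S X + X T = 0\<close>; multiplying by \<open>X\<close>
  and taking traces gives a vanishing sum of the nonnegative traces of \<open>X S X\<close> and \<open>X T X\<close>.\<close>

lemma psd_sqrt_unique:
  fixes S T :: "real ^ 'n ^ 'n"
  assumes S: "psd S" and T: "psd T" and eq: "S ** S = T ** T"
    and pos: "\<And>v. v \<noteq> 0 \<Longrightarrow> 0 < v \<bullet> (T *v v)"
  shows "S = T"
proof -
  define X where "X = S - T"
  have X: "transpose X = X"
    using S T by (simp add: X_def psd_def symmetric_mat_def transpose_def vec_eq_iff)
  have "S ** X + X ** T = S ** S - T ** T"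
    by (simp add: X_def matrix_eq matrix_vector_mult_add_rdistrib matrix_vector_mult_diff_rdistrib
        matrix_vector_mult_diff_distrib flip: matrix_vector_mul_assoc)
  then have "X ** (S ** X + X ** T) = 0" by (simp add: eq)
  then have "trace (X ** (S ** X)) + trace (X ** (X ** T)) = 0"
    by (metis matrix_add_ldistrib trace_add trace_0 mat_0)
  moreover have "trace (X ** (X ** T)) = trace (X ** T ** X)"
    by (metis matrix_mul_assoc trace_mul_sym)
  ultimately have "trace (transpose X ** S ** X) + trace (transpose X ** T ** X) = 0"
    by (simp add: X matrix_mul_assoc)
  moreover have "0 \<le> trace (transpose X ** M ** X)" if "psd M" for M
    using that unfolding trace_congruence psd_def by (intro sum_nonneg) simp
  ultimately have "trace (transpose X ** T ** X) = 0"
    using S T by (smt (verit))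
  then have "column i X \<bullet> (T *v column i X) = 0" for i
    using T unfolding trace_congruence psd_def by (subst (asm) sum_nonneg_eq_0_iff) auto
  then have "column i X = 0" for i using pos by (metis less_irrefl)
  then have "X = 0" by (simp add: column_def vec_eq_iff)
  then show ?thesis by (simp add: X_def)
qed

lemma norm_le_quadratic_form:
  assumes "loewner_le (mat 1) Q"
  shows "(norm v)\<^sup>2 \<le> v \<bullet> (Q *v v)"
proof -
  have "0 \<le> v \<bullet> ((Q - mat 1) *v v)" using assms by (simp add: loewner_le_def psd_def)
  then show ?thesis
    by (simp add: matrix_vector_mult_diff_rdistrib inner_diff_right power2_norm_eq_inner)
qed

text \<open>After scaling \<open>Q = L (I - B)\<close> with \<open>\<parallel>B\<parallel> < 1\<close>, the square root is \<open>\<surd>L (I - Y)\<close>,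
  where \<open>Y\<close> is the fixed point of the contraction \<open>Y \<mapsto> (B + Y\<^sup>2) / 2\<close>.\<close>

lemma psd_sqrt_exists:
  fixes Q :: "real ^ 'n ^ 'n"
  assumes sym: "symmetric_mat Q" and ge: "loewner_le (mat 1) Q"
  shows "\<exists>T. psd T \<and> T ** T = Q \<and> (\<forall>v. v \<noteq> 0 \<longrightarrow> 0 < v \<bullet> (T *v v))"
proof -
  \<comment> \<open>The fixed-point argument runs among bounded linear operators, a complete space
    with a submultiplicative norm.\<close>
  define q where "q = Blinfun ((*v) Q)"
  have q: "blinfun_apply q v = Q *v v" for v
    by (simp add: q_def bounded_linear_Blinfun_apply)
  \<comment> \<open>\<open>L\<close> dominates the squared operator norm of \<open>Q\<close>, so
    |Qv|^2 <= L |v|^2. Together with v.Qv >= |v|^2, the expansion of |Bv|^2 is at most (1 - 2/L +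
    1/L) |v|^2 = r^2 |v|^2.\<close>
  define L where "L = (norm q)\<^sup>2 + 1"
  have L: "L \<ge> 1" by (simp add: L_def)
  define r where "r = sqrt (1 - 1 / L)"
  have r: "0 \<le> r" "r < 1" "r\<^sup>2 = 1 - 1 / L"
    using L by (auto simp: r_def)
  define B where "B = id_blinfun - (1 / L) *\<^sub>R q"
  have Bv: "B v = v - (1 / L) *\<^sub>R (Q *v v)" for v
    by (simp add: B_def blinfun.bilinear_simps q)
  have Bsym: "u \<bullet> B v = B u \<bullet> v" for u v
    using sym by (simp add: Bv symmetric_mat_iff inner_diff_left inner_diff_right)
  have Bnorm: "norm B \<le> r"
  proof (rule norm_blinfun_bound[OF r(1)])
    fix v
    have "(norm (B v))\<^sup>2 = (norm v)\<^sup>2 - 2 / L * (v \<bullet> (Q *v v)) + (norm (Q *v v))\<^sup>2 / L\<^sup>2"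
      by (simp only: Bv power2_norm_eq_inner)
        (simp add: inner_diff_left inner_diff_right inner_commute algebra_simps power2_eq_square)
    also have "\<dots> \<le> (norm v)\<^sup>2 - 2 / L * (norm v)\<^sup>2 + (norm v)\<^sup>2 / L"
    proof -
      have "2 / L * (norm v)\<^sup>2 \<le> 2 / L * (v \<bullet> (Q *v v))"
        using L norm_le_quadratic_form[OF ge, of v] by (intro mult_left_mono) auto
      moreover have "(norm (Q *v v))\<^sup>2 \<le> (norm q * norm v)\<^sup>2"
        using norm_blinfun[of q v] by (intro power_mono) (auto simp: q)
      then have "(norm (Q *v v))\<^sup>2 \<le> L * (norm v)\<^sup>2"
        unfolding L_def power_mult_distrib distrib_right
        by (smt (verit) zero_le_power2)
      then have "(norm (Q *v v))\<^sup>2 / L\<^sup>2 \<le> (norm v)\<^sup>2 / L"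
        using L by (simp add: field_simps power2_eq_square)
      ultimately show ?thesis by linarith
    qed
    also have "\<dots> = (r * norm v)\<^sup>2"
      by (simp add: power_mult_distrib r(3) algebra_simps)
    finally show "norm (B v) \<le> r * norm v"
      using r(1) by (metis power2_le_imp_le mult_nonneg_nonneg norm_ge_zero)
  qed
  \<comment> \<open>Symmetry is built into the set because \<open>f\<close> preserves it: the fixed
    point is then symmetric, and so is \<open>T\<close>. The radius \<open>r\<close> < 1 later gives
    positivity of \<open>T\<close>.\<close>
  define C :: "((real ^ 'n) \<Rightarrow>\<^sub>L (real ^ 'n)) set" where
    "C = cball 0 r \<inter> {Y. \<forall>u v. u \<bullet> blinfun_apply Y v = blinfun_apply Y u \<bullet> v}"
  define f where "f = (\<lambda>Y. (1 / 2) *\<^sub>R (B + (Y o\<^sub>L Y)))"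
  have "closed C"
    unfolding C_def by (intro closed_Int closed_cball closed_Collect_all closed_Collect_eq continuous_intros)
  moreover have "C \<noteq> {}" by (rule ex_in_conv[THEN iffD1], rule exI[of _ 0]) (simp add: C_def r)
  moreover have "f ` C \<subseteq> C"
  proof safe
    fix Y assume Y: "Y \<in> C"
    have "norm (Y o\<^sub>L Y) \<le> norm Y * norm Y" by (rule norm_blinfun_compose)
    also have "\<dots> \<le> r * 1" using Y r by (intro mult_mono) (auto simp: C_def)
    finally have "norm (B + (Y o\<^sub>L Y)) \<le> r + r" using Bnorm norm_triangle_mono by fastforce
    then have "norm (f Y) \<le> r" by (simp add: f_def)
    moreover have "u \<bullet> f Y v = f Y u \<bullet> v" for u v
      using Y by (simp add: f_def C_def blinfun.bilinear_simps inner_add_left inner_add_right Bsym)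
    ultimately show "f Y \<in> C" by (simp add: C_def)
  qed
  moreover have "dist (f Y) (f Z) \<le> r * dist Y Z" if "Y \<in> C" "Z \<in> C" for Y Z
  proof -
    \<comment> \<open>Operators need not commute, so the difference of squares is split as Y (Y - Z)
      + (Y - Z) Z; after halving, each summand contributes at most r/2 times the distance.\<close>
    have "f Y - f Z = (1 / 2) *\<^sub>R ((Y o\<^sub>L (Y - Z)) + ((Y - Z) o\<^sub>L Z))"
      by (rule blinfun_eqI) (simp add: f_def blinfun.bilinear_simps algebra_simps)
    then have "norm (f Y - f Z) = (1 / 2) * norm ((Y o\<^sub>L (Y - Z)) + ((Y - Z) o\<^sub>L Z))"
      by simp
    also have "\<dots> \<le> (1 / 2) * (norm Y * norm (Y - Z) + norm (Y - Z) * norm Z)"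
      by (intro mult_left_mono norm_triangle_mono norm_blinfun_compose) auto
    also have "\<dots> \<le> (1 / 2) * (r * norm (Y - Z) + norm (Y - Z) * r)"
      using that by (intro mult_left_mono add_mono mult_right_mono) (auto simp: C_def)
    finally show ?thesis by (simp add: dist_norm algebra_simps)
  qed
  ultimately obtain Y where Y: "Y \<in> C" "f Y = Y"
    using Banach_fix[of C r f] r complete_eq_closed by metis
  \<comment> \<open>The fixed point satisfies 2 Y = B + Y^2, hence (I - Y)^2 = I - 2 Y + Y^2 = I - B
    = Q / L.\<close>
  define T where "T = sqrt L *\<^sub>R (mat 1 - matrix Y)"
  have Tv: "T *v v = sqrt L *\<^sub>R (v - Y v)" for v
    by (simp add: T_def scaleR_matrix_vector_assoc[symmetric] matrix_vector_mult_diff_rdistrib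
        matrix_works blinfun.bounded_linear_right bounded_linear.linear)
  have fix_eq: "2 *\<^sub>R Y v = B v + Y (Y v)" for v
  proof -
    have "Y v = (1 / 2) *\<^sub>R (B v + Y (Y v))"
      by (subst (1) Y(2)[symmetric]) (simp add: f_def blinfun.bilinear_simps)
    then show ?thesis by (metis (no_types) scaleR_half_double scaleR_2 scaleR_right_distrib inverse_eq_divide)
  qed
  have "T ** T = Q"
  proof (rule matrix_eq[THEN iffD2], rule allI)
    fix v
    have "(T ** T) *v v = sqrt L *\<^sub>R sqrt L *\<^sub>R (v - Y v - Y (v - Y v))"
      by (simp only: matrix_vector_mul_assoc[symmetric] Tv blinfun.bilinear_simps scaleR_diff_right)
    also have "\<dots> = L *\<^sub>R (v - 2 *\<^sub>R Y v + Y (Y v))"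
      using L by (simp add: blinfun.bilinear_simps scaleR_2 algebra_simps)
    also have "\<dots> = L *\<^sub>R (v - B v)" by (simp add: fix_eq)
    also have "\<dots> = Q *v v" using L by (simp add: Bv)
    finally show "(T ** T) *v v = Q *v v" .
  qed
  moreover have pos: "0 < v \<bullet> (T *v v)" if "v \<noteq> 0" for v
  proof -
    have "v \<bullet> Y v \<le> norm v * norm (Y v)" by (rule norm_cauchy_schwarz)
    also have "\<dots> \<le> norm v * (r * norm v)"
      using Y(1) by (intro mult_left_mono norm_blinfun[THEN order_trans] mult_right_mono) (auto simp: C_def)
    also have "\<dots> < norm v * norm v"
      using r that by (simp)
    finally have "v \<bullet> Y v < v \<bullet> v" by (simp add: norm_eq_sqrt_inner)
    then show ?thesis using L by (simp add: Tv inner_diff_right)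
  qed
  moreover have "psd T"
    unfolding psd_def symmetric_mat_iff
  proof (intro conjI allI)
    show "u \<bullet> (T *v v) = (T *v u) \<bullet> v" for u v
      using Y(1) by (simp add: Tv C_def inner_diff_left inner_diff_right)
    show "0 \<le> v \<bullet> (T *v v)" for v
      using pos[of v] by (cases "v = 0") auto
  qed
  ultimately show ?thesis by blast
qed

text \<open>Existence and uniqueness resolve the description in \<open>psd_sqrt\<close> once and for
  all. The first fact translates norms weighted by the root into the quadratic forms of the Lyapunov
  function; the second holds because the root is positive definite, hence has trivial
  kernel.\<close>

lemma psd_sqrt_properties:
  fixes Q :: "real ^ 'n ^ 'n"
  assumes "symmetric_mat Q" and "loewner_le (mat 1) Q"
  shows norm_psd_sqrt: "(norm (psd_sqrt Q *v v))\<^sup>2 = v \<bullet> (Q *v v)"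
    and invertible_psd_sqrt: "invertible (psd_sqrt Q)"
proof -
  obtain T where T: "psd T" "T ** T = Q" and pos: "\<And>v. v \<noteq> 0 \<Longrightarrow> 0 < v \<bullet> (T *v v)"
    using psd_sqrt_exists[OF assms] by blast
  have eq: "psd_sqrt Q = T"
    unfolding psd_sqrt_def
  proof (rule the_equality)
    fix S assume "psd S \<and> S ** S = Q"
    then have "psd S" and "S ** S = T ** T" using T(2) by auto
    then show "S = T" using psd_sqrt_unique[OF _ T(1) _ pos] by blast
  qed (use T in simp)
  show "(norm (psd_sqrt Q *v v))\<^sup>2 = v \<bullet> (Q *v v)"
    using T unfolding eq power2_norm_eq_inner
    by (metis matrix_vector_mul_assoc psd_def symmetric_mat_iff)
  have "v = 0" if "T *v v = 0" for v using pos[of v] that by auto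
  then show "invertible (psd_sqrt Q)"
    unfolding eq invertible_left_inverse matrix_left_invertible_ker by blast
qed

section \<open>Weighted operator norms, uniform bounds and block vectors\<close>

lemma spectral_norm_weighted:
  fixes S :: "real ^ 'n ^ 'n" and M :: "real ^ 'm ^ 'n" and T :: "real ^ 'm ^ 'm"
  assumes "invertible T"
  shows "norm (S *v (M *v x)) \<le> spectral_norm (S ** M ** matrix_inv T) * norm (T *v x)"
proof -
  \<comment> \<open>Cancelling \<open>matrix_inv T ** T\<close> turns the weighted spectral norms
    inside \<open>gamma11\<close> and \<open>gamma12\<close> into inequalities between weighted
    vector norms.\<close>
  have "matrix_inv T ** T = mat 1"
    using assms unfolding invertible_def matrix_inv_def by (rule someI2_ex) simp
  then have "(S ** M ** matrix_inv T) *v (T *v x) = S *v (M *v x)"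
    by (simp add: matrix_vector_mul_assoc flip: matrix_mul_assoc)
  then show ?thesis
    unfolding spectral_norm_def
    using onorm[OF matrix_vector_mul_bounded_linear, of "S ** M ** matrix_inv T" "T *v x"] by simp
qed

text \<open>With finitely many indices, the sum of the operator norms serves as a common
  bound.\<close>

lemma matrices_uniform_bound:
  fixes M :: "'k::finite \<Rightarrow> real ^ 'm ^ 'n"
  shows "\<exists>c. \<forall>k v. norm (M k *v v) \<le> c * norm v"
proof -
  have "norm (M k *v v) \<le> (\<Sum>k\<in>UNIV. onorm ((*v) (M k))) * norm v" for k v
  proof -
    have "norm (M k *v v) \<le> onorm ((*v) (M k)) * norm v"
      by (intro onorm matrix_vector_mul_bounded_linear)
    also have "\<dots> \<le> (\<Sum>k\<in>UNIV. onorm ((*v) (M k))) * norm v"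
      by (intro mult_right_mono member_le_sum) (auto intro: onorm_pos_le)
    finally show ?thesis .
  qed
  then show ?thesis by blast
qed

lemma norm_block_vec: "(norm (block_vec x y))\<^sup>2 = (norm x)\<^sup>2 + (norm y)\<^sup>2"
proof -
  have "norm (block_vec x y) ^ 2 = (\<Sum>k\<in>UNIV <+> UNIV. block_vec x y $ k * block_vec x y $ k)"
    by (simp add: power2_norm_eq_inner inner_vec_def)
  also have "\<dots> = (norm x)\<^sup>2 + (norm y)\<^sup>2"
    by (subst sum.Plus) (simp_all add: block_vec_def power2_norm_eq_inner inner_vec_def)
  finally show ?thesis .
qed

lemma matrix_vector_mult_block_vec:
  "M *v block_vec x y =
    block_vec (block11 M *v x + block12 M *v y) (block21 M *v x + block22 M *v y)"
proof -
  have s: "(\<Sum>k\<in>UNIV. h k) = (\<Sum>i\<in>UNIV. h (Inl i)) + (\<Sum>j\<in>UNIV. h (Inr j))"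
    for h :: "'a::finite + 'b::finite \<Rightarrow> real"
    by (subst UNIV_Plus_UNIV[symmetric], subst sum.Plus) simp_all
  show ?thesis
    by (auto simp: vec_eq_iff matrix_vector_mult_def s block_vec_def block11_def block12_def
        block21_def block22_def split: sum.split)
qed

lemma block_vec_eq_iff: "block_vec x y = block_vec x' y' \<longleftrightarrow> x = x' \<and> y = y'"
proof -
  have "norm (block_vec x y - block_vec x' y') ^ 2 = norm (x - x') ^ 2 + norm (y - y') ^ 2"
    unfolding norm_block_vec[symmetric]
    by (rule arg_cong[where f = "\<lambda>v. norm v ^ 2"])
      (simp add: vec_eq_iff block_vec_def split: sum.split)
  then show ?thesis
    by (metis eq_iff_diff_eq_0 norm_eq_zero sum_power2_eq_zero_iff zero_eq_power2)
qed


section \<open>Energy decay along the flow of one mode\<close>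

lemma quadratic_form_derivative:
  assumes "symmetric_mat Q" and "(x has_vector_derivative x') (at s within I)"
  shows "((\<lambda>s. x s \<bullet> (Q *v x s)) has_real_derivative 2 * (x s \<bullet> (Q *v x'))) (at s within I)"
proof -
  have "((\<lambda>s. Q *v x s) has_vector_derivative Q *v x') (at s within I)"
    by (rule bounded_linear.has_vector_derivative[OF matrix_vector_mul_bounded_linear assms(2)])
  from bounded_bilinear.has_vector_derivative[OF bounded_bilinear_inner assms(2) this]
  have "((\<lambda>s. x s \<bullet> (Q *v x s)) has_real_derivative x s \<bullet> (Q *v x') + x' \<bullet> (Q *v x s)) (at s within I)"
    by (simp add: has_real_derivative_iff_has_vector_derivative)
  moreover have "x' \<bullet> (Q *v x s) = x s \<bullet> (Q *v x')"
    using assms(1) by (metis inner_commute symmetric_mat_iff)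
  ultimately show ?thesis by simp
qed

text \<open>Gronwall's argument with an integrating factor. At \<open>a\<close> only a one-sided
  derivative is available, so monotonicity of \<open>g\<close> follows from the sign of its
  derivative at interior points and continuity up to \<open>a\<close>.\<close>

lemma exponential_decay:
  fixes V :: "real \<Rightarrow> real"
  assumes deriv: "\<And>s. s \<in> {a..<b} \<Longrightarrow> (V has_real_derivative D s) (at s within {a..<b})"
    and le: "\<And>s. s \<in> {a..<b} \<Longrightarrow> D s \<le> - c * V s"
    and s: "s \<in> {a..<b}"
  shows "V s \<le> exp (- c * (s - a)) * V a"
proof -
  define g where "g = (\<lambda>r. exp (c * (r - a)) * V r)"
  have der: "(g has_real_derivative exp (c * (r - a)) * (D r + c * V r)) (at r within {a..<b})"
    if "r \<in> {a..<b}" for r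
    unfolding g_def using deriv[OF that]
    by (auto intro!: derivative_eq_intros simp: algebra_simps)
  have "g s \<le> g a"
  proof (rule DERIV_nonpos_imp_decreasing_open[of a s g])
    show "a \<le> s" using s by simp
    fix r assume r: "a < r" "r < s"
    then have "r \<in> interior {a..<b}" using s by simp
    then have "at r within {a..<b} = at r" by (rule at_within_interior)
    moreover have "exp (c * (r - a)) * (D r + c * V r) \<le> 0"
      using le[of r] r s by (intro mult_nonneg_nonpos) auto
    ultimately show "\<exists>y. (g has_real_derivative y) (at r) \<and> y \<le> 0"
      using der[of r] r s by auto
  next
    have "continuous_on {a..<b} g"
      using der by (meson continuous_on_eq_continuous_within DERIV_continuous)
    then show "continuous_on {a..s} g"
      by (rule continuous_on_subset) (use s in auto)
  qed
  then have "exp (c * (s - a)) * V s \<le> V a" by (simp add: g_def)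
  then have "exp (- c * (s - a)) * (exp (c * (s - a)) * V s) \<le> exp (- c * (s - a)) * V a"
    by (rule mult_left_mono) simp
  then show ?thesis by (simp add: mult.assoc[symmetric] exp_add[symmetric])
qed

text \<open>Here \<open>u\<close>, \<open>v\<close> are the norms of the slow and the fast state, \<open>X\<close> and \<open>Y / \<epsilon>\<close> are half the
  derivatives of the forms \<open>p\<close> and \<open>q\<close>, and \<open>r\<close> is the derivative of the weight \<open>\<phi>\<close>. The term
  \<open>2 c u v\<close> is split by Young's inequality; \<open>\<kappa>\<close> is large enough to absorb its \<open>v\<close>-part.\<close>

lemma dissipation_inequality:
  fixes u v :: real
  assumes pos: "0 < l" "1 \<le> c" "0 < e" "0 \<le> u" "0 \<le> v"
    and pq: "u\<^sup>2 \<le> p" "v\<^sup>2 \<le> q"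
    and \<phi>: "1 \<le> \<phi>" "\<phi> \<le> m"
    and \<kappa>: "8 * c\<^sup>2 / l\<^sup>2 \<le> \<kappa>"
    and e: "2 * \<kappa> * m * c * e \<le> l" "12 * c * e \<le> l" "2 * e \<le> 1"
    and X: "X \<le> - l * p + c * (u * v)"
    and Y: "Y \<le> - l * q + e * c * (u * v) + e * c * v\<^sup>2"
    and r: "e * r \<le> l"
  shows "2 * X + \<kappa> * (e * r) * q + 2 * \<kappa> * \<phi> * Y \<le> - l * (p + e * \<kappa> * \<phi> * q)"
proof -
  have \<kappa>0: "0 < \<kappa>" using \<kappa> pos by (smt (verit) divide_pos_pos zero_less_power)
  have q0: "0 \<le> q" using pq(2) by (rule order_trans[OF zero_le_power2])
  have young: "2 * (c * (u * v)) \<le> l / 2 * u\<^sup>2 + 2 * c\<^sup>2 / l * v\<^sup>2"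
  proof -
    have "0 \<le> (l * u - 2 * c * v)\<^sup>2 / (2 * l)" using pos by simp
    also have "\<dots> = l / 2 * u\<^sup>2 + 2 * c\<^sup>2 / l * v\<^sup>2 - 2 * (c * (u * v))"
      using pos by (simp add: field_simps power2_eq_square)
    finally show ?thesis by simp
  qed
  have c\<kappa>: "2 * c\<^sup>2 / l \<le> \<kappa> * \<phi> * (l / 4)"
  proof -
    have "2 * c\<^sup>2 / l = 8 * c\<^sup>2 / l\<^sup>2 * (l / 4)" using pos by (simp add: field_simps power2_eq_square)
    also have "\<dots> \<le> \<kappa> * (l / 4)" using \<kappa> pos by (intro mult_right_mono) auto
    also have "\<dots> \<le> \<kappa> * \<phi> * (l / 4)" using \<phi> pos \<kappa>0 by (intro mult_right_mono) auto
    finally show ?thesis .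
  qed
  have uv: "2 * (u * v) \<le> u\<^sup>2 + v\<^sup>2" using sum_squares_bound[of u v] by (simp add: mult.assoc)
  have k\<phi>: "0 < \<kappa> * \<phi>" using \<kappa>0 \<phi> by simp
  have "\<kappa> * \<phi> * (2 * Y) \<le> \<kappa> * \<phi> * (- 2 * l * q + e * c * u\<^sup>2 + 3 * (e * c) * v\<^sup>2)"
  proof (rule mult_left_mono)
    have "e * c * (2 * (u * v)) \<le> e * c * (u\<^sup>2 + v\<^sup>2)" using uv pos by (intro mult_left_mono) auto
    then show "2 * Y \<le> - 2 * l * q + e * c * u\<^sup>2 + 3 * (e * c) * v\<^sup>2"
      using Y by (simp add: algebra_simps)
  qed (use k\<phi> in simp)
  moreover have "\<kappa> * \<phi> * (e * c * u\<^sup>2) \<le> l / 2 * u\<^sup>2"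
  proof -
    have "\<kappa> * \<phi> * (e * c) \<le> \<kappa> * m * (e * c)"
      using \<kappa>0 \<phi> pos by (intro mult_right_mono mult_left_mono) auto
    also have "\<dots> \<le> l / 2" using e by (simp add: algebra_simps)
    finally have "\<kappa> * \<phi> * (e * c) * u\<^sup>2 \<le> l / 2 * u\<^sup>2" by (rule mult_right_mono) simp
    then show ?thesis by (simp add: algebra_simps)
  qed
  moreover have "\<kappa> * \<phi> * (3 * (e * c) * v\<^sup>2) \<le> \<kappa> * \<phi> * (l / 4 * v\<^sup>2)"
    using e k\<phi> by (intro mult_left_mono mult_right_mono) (auto simp: algebra_simps)
  moreover have "2 * c\<^sup>2 / l * v\<^sup>2 \<le> \<kappa> * \<phi> * (l / 4) * v\<^sup>2"
    using c\<kappa> by (rule mult_right_mono) simp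
  moreover have "\<kappa> * (e * r) * q \<le> \<kappa> * \<phi> * (l * q)"
  proof -
    have "\<kappa> * (e * r) * q \<le> \<kappa> * l * q" using r \<kappa>0 q0 by (intro mult_right_mono mult_left_mono) auto
    also have "\<dots> \<le> \<kappa> * \<phi> * (l * q)"
      using mult_right_mono[OF \<phi>(1), of "\<kappa> * l * q"] \<kappa>0 pos q0 by (simp add: algebra_simps)
    finally show ?thesis .
  qed
  moreover have "l * u\<^sup>2 \<le> l * p" using pq pos by simp
  moreover have "\<kappa> * \<phi> * (l / 2 * v\<^sup>2) \<le> \<kappa> * \<phi> * (l / 2 * q)"
    using pq pos k\<phi> by (intro mult_left_mono) auto
  moreover have "\<kappa> * \<phi> * (l * (e * q)) \<le> \<kappa> * \<phi> * (l * (1 / 2 * q))"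
    using e q0 pos k\<phi> by (intro mult_left_mono mult_right_mono) auto
  \<comment> \<open>The budget: of the -2lp in \<open>2 * X\<close>, half pays for the two terms
    (l/2) u^2 and half remains. Of the -2lq, with common factor \<open>\<kappa> * \<phi>\<close>,
    one l pays for the growth of the weight, l/4 each for the Young term and the
    \<open>3 * (e * c)\<close> term, and l/2 is left for the target, since e <= 1/2.\<close>
  ultimately show ?thesis using young X by (simp add: algebra_simps)
qed

text \<open>The matrices \<open>F\<close>, \<open>G\<close>, \<open>C1\<close>, \<open>C2\<close>,
  \<open>C3\<close> stand for \<open>slow_A0\<close>, \<open>block22\<close>, \<open>B1\<close>,
  \<open>B2\<close>, \<open>B3\<close> of the active mode. The weight is 1 at \<open>a\<close>, so
  it is absent on the right; near \<open>b\<close> it approaches \<open>g + 1\<close>, the reserve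
  spent at the next jump.\<close>

lemma flow_decay:
  fixes x :: "real \<Rightarrow> real ^ 'x" and y :: "real \<Rightarrow> real ^ 'z"
    and P :: "real ^ 'x ^ 'x" and Q :: "real ^ 'z ^ 'z"
  assumes sym: "symmetric_mat P" "symmetric_mat Q"
    and ge: "loewner_le (mat 1) P" "loewner_le (mat 1) Q"
    and lyap: "\<And>v. v \<bullet> (P *v (F *v v)) \<le> - l * (v \<bullet> (P *v v))"
      "\<And>v. v \<bullet> (Q *v (G *v v)) \<le> - l * (v \<bullet> (Q *v v))"
    and bounds: "\<And>v. norm (P *v (C1 *v v)) \<le> c * norm v" "\<And>v. norm (Q *v (C2 *v v)) \<le> c * norm v"
      "\<And>v. norm (Q *v (C3 *v v)) \<le> c * norm v"
    and pos: "0 < l" "1 \<le> c" "0 < e" "0 < g" and ab: "a < b"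
    and \<kappa>: "8 * c\<^sup>2 / l\<^sup>2 \<le> \<kappa>"
    and e: "2 * \<kappa> * (g + 1) * c * e \<le> l" "12 * c * e \<le> l" "2 * e \<le> 1"
    and dwell: "e * (g / (b - a)) \<le> l"
    and ode: "\<And>s. s \<in> {a..<b} \<Longrightarrow> \<exists>x' y'. (x has_vector_derivative x') (at s within {a..<b}) \<and>
        (y has_vector_derivative y') (at s within {a..<b}) \<and>
        x' = F *v x s + C1 *v y s \<and> e *\<^sub>R y' = e *\<^sub>R (C2 *v x s) + (G + e *\<^sub>R C3) *v y s"
    and s: "s \<in> {a..<b}"
  shows "x s \<bullet> (P *v x s) + e * \<kappa> * (1 + g * (s - a) / (b - a)) * (y s \<bullet> (Q *v y s))
    \<le> exp (- l * (s - a)) * (x a \<bullet> (P *v x a) + e * \<kappa> * (y a \<bullet> (Q *v y a)))"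
proof -
  define \<phi> where "\<phi> = (\<lambda>s. 1 + g * (s - a) / (b - a))"
  define V where "V = (\<lambda>s. x s \<bullet> (P *v x s) + e * \<kappa> * \<phi> s * (y s \<bullet> (Q *v y s)))"
  obtain x' y' where ode': "\<And>s. s \<in> {a..<b} \<Longrightarrow> (x has_vector_derivative x' s) (at s within {a..<b}) \<and>
        (y has_vector_derivative y' s) (at s within {a..<b}) \<and>
        x' s = F *v x s + C1 *v y s \<and> e *\<^sub>R y' s = e *\<^sub>R (C2 *v x s) + (G + e *\<^sub>R C3) *v y s"
    using ode by metis
  define X where "X = (\<lambda>s. x s \<bullet> (P *v x' s))"
  \<comment> \<open>With the factor \<open>e\<close> kept inside \<open>Y\<close>, the fast equation
    can be substituted as it stands, without dividing by \<open>e\<close>.\<close>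
  define Y where "Y = (\<lambda>s. y s \<bullet> (Q *v (e *\<^sub>R y' s)))"
  have "V s \<le> exp (- l * (s - a)) * V a"
  proof (rule exponential_decay[OF _ _ s])
    fix r assume r: "r \<in> {a..<b}"
    note o = ode'[OF r]
    have d\<phi>: "(\<phi> has_real_derivative g / (b - a)) (at r within {a..<b})"
      unfolding \<phi>_def using ab by (auto intro!: derivative_eq_intros)
    have dx: "((\<lambda>s. x s \<bullet> (P *v x s)) has_real_derivative 2 * X r) (at r within {a..<b})"
      unfolding X_def using o by (intro quadratic_form_derivative sym) auto
    have dy: "((\<lambda>s. y s \<bullet> (Q *v y s)) has_real_derivative 2 * (y r \<bullet> (Q *v y' r))) (at r within {a..<b})"
      using o by (intro quadratic_form_derivative sym) auto
    have Ye: "Y r = e * (y r \<bullet> (Q *v y' r))"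
      by (simp add: Y_def matrix_vector_mult_scaleR)
    show "(V has_real_derivative 2 * X r + \<kappa> * (e * (g / (b - a))) * (y r \<bullet> (Q *v y r))
        + 2 * \<kappa> * \<phi> r * Y r) (at r within {a..<b})"
      unfolding V_def Ye
      by (rule derivative_eq_intros d\<phi> dx dy refl | simp add: algebra_simps)+
    have cs: "w \<bullet> z \<le> c * (norm w * n)" if "norm z \<le> c * n" for w z :: "real ^ 'k" and n
    proof -
      have "w \<bullet> z \<le> norm w * norm z" by (rule norm_cauchy_schwarz)
      also have "\<dots> \<le> norm w * (c * n)" using that by (intro mult_left_mono) auto
      finally show ?thesis by (simp add: algebra_simps)
    qed
    show "2 * X r + \<kappa> * (e * (g / (b - a))) * (y r \<bullet> (Q *v y r)) + 2 * \<kappa> * \<phi> r * Y r \<le> - l * V r"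
      unfolding V_def
    proof (rule dissipation_inequality[OF pos(1-3) norm_ge_zero norm_ge_zero
          norm_le_quadratic_form[OF ge(1)] norm_le_quadratic_form[OF ge(2)] _ _ \<kappa> e _ _ dwell])
      show "1 \<le> \<phi> r" using r pos ab by (simp add: \<phi>_def)
      have "(r - a) / (b - a) \<le> 1" using r ab by (simp add: field_simps)
      then show "\<phi> r \<le> g + 1" using pos mult_left_mono[of "(r - a) / (b - a)" 1 g] by (simp add: \<phi>_def)
      have "X r = x r \<bullet> (P *v (F *v x r)) + x r \<bullet> (P *v (C1 *v y r))"
        using o by (simp add: X_def matrix_vector_right_distrib inner_add_right)
      then show "X r \<le> - l * (x r \<bullet> (P *v x r)) + c * (norm (x r) * norm (y r))"
        using lyap(1)[of "x r"] cs[OF bounds(1), of "x r" "y r"] by linarith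
      have "Y r = e * (y r \<bullet> (Q *v (C2 *v x r))) + y r \<bullet> (Q *v (G *v y r)) + e * (y r \<bullet> (Q *v (C3 *v y r)))"
      proof -
        have "e *\<^sub>R y' r = e *\<^sub>R (C2 *v x r) + (G *v y r + e *\<^sub>R (C3 *v y r))"
          using o by (simp add: matrix_vector_mult_add_rdistrib scaleR_matrix_vector_assoc)
        then have "Y r = y r \<bullet> (Q *v (e *\<^sub>R (C2 *v x r) + (G *v y r + e *\<^sub>R (C3 *v y r))))"
          by (simp only: Y_def)
        then show ?thesis
          by (simp add: matrix_vector_right_distrib inner_add_right matrix_vector_mult_scaleR)
      qed
      moreover have "e * (y r \<bullet> (Q *v (C2 *v x r))) \<le> e * (c * (norm (y r) * norm (x r)))"
        "e * (y r \<bullet> (Q *v (C3 *v y r))) \<le> e * (c * (norm (y r) * norm (y r)))"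
        using pos by (auto intro!: mult_left_mono cs bounds)
      ultimately show "Y r \<le> - l * (y r \<bullet> (Q *v y r)) + e * c * (norm (x r) * norm (y r)) + e * c * (norm (y r))\<^sup>2"
        using lyap(2)[of "y r"] by (simp add: power2_eq_square mult.assoc mult.commute[of "norm (x r)"])
    qed
  qed
  then show ?thesis by (simp add: V_def \<phi>_def)
qed

section \<open>From geometric decay over events to asymptotic stability\<close>

lemma event_times_cases:
  assumes "event_times t" and "0 \<le> s"
  obtains k where "t k \<le> s" and "s < t (Suc k)"
proof -
  obtain n where "s < t n" using assms(1) by (auto simp: event_times_def bdd_above_def not_le)
  then have n: "s < t (LEAST n. s < t n)" by (rule LeastI)
  \<comment> \<open>The least index is not 0 because \<open>t 0 = 0\<close> does not exceed
    \<open>s\<close>; its predecessor is the wanted \<open>k\<close>.\<close>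
  moreover have "(LEAST n. s < t n) \<noteq> 0" using n assms by (auto simp: event_times_def)
  ultimately obtain k where k: "(LEAST n. s < t n) = Suc k" by (auto simp: gr0_conv_Suc)
  then have "\<not> s < t k" using not_less_Least[of k "\<lambda>n. s < t n"] by simp
  then show ?thesis using that[of k] n k by simp
qed

text \<open>Stability uses only \<open>\<theta> ^ k\<close> <= 1 and that \<open>C\<close> is the
  same for all solutions. Attraction uses that times beyond \<open>t N\<close> lie in intervals of
  index at least \<open>N\<close>, where \<open>\<theta> ^ k\<close> is small.\<close>

lemma globally_asymptotically_stable_HI:
  assumes t: "event_times t" and \<theta>: "0 \<le> \<theta>" "\<theta> < 1" and C: "0 < C"
    and bound: "\<And>x y k s. solution_H \<epsilon> A J t \<sigma> \<nu> x y \<Longrightarrow> t k \<le> s \<Longrightarrow> s < t (Suc k) \<Longrightarrow>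
      (norm (block_vec (x s) (y s)))\<^sup>2 \<le> C * \<theta> ^ k * (norm (block_vec (x 0) (y 0)))\<^sup>2"
  shows "globally_asymptotically_stable_H \<epsilon> A J t \<sigma> \<nu>"
  unfolding globally_asymptotically_stable_H_def
proof (intro conjI allI impI)
  fix \<rho> :: real assume \<rho>: "0 < \<rho>"
  have "norm (block_vec (x s) (y s)) < \<rho>"
    if sol: "solution_H \<epsilon> A J t \<sigma> \<nu> x y" and small: "norm (block_vec (x 0) (y 0)) < \<rho> / sqrt C" and s: "0 \<le> s"
    for x y s
  proof -
    obtain k where "t k \<le> s" "s < t (Suc k)" using event_times_cases[OF t s] .
    from bound[OF sol this] have "(norm (block_vec (x s) (y s)))\<^sup>2
      \<le> C * \<theta> ^ k * (norm (block_vec (x 0) (y 0)))\<^sup>2" .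
    also have "\<dots> \<le> C * 1 * (norm (block_vec (x 0) (y 0)))\<^sup>2"
      using \<theta> C by (intro mult_right_mono mult_left_mono power_le_one) auto
    also have "\<dots> < C * 1 * (\<rho> / sqrt C)\<^sup>2"
      using small C by (intro mult_strict_left_mono power_strict_mono) auto
    also have "\<dots> = \<rho>\<^sup>2" using C by (simp add: power_divide)
    finally show ?thesis using \<rho> by (simp add: power2_less_imp_less)
  qed
  then show "\<exists>\<delta>>0. \<forall>x y. solution_H \<epsilon> A J t \<sigma> \<nu> x y \<and> norm (block_vec (x 0) (y 0)) < \<delta> \<longrightarrow>
      (\<forall>s\<ge>0. norm (block_vec (x s) (y s)) < \<rho>)"
    using \<rho> C by (intro exI[of _ "\<rho> / sqrt C"]) auto
next
  fix x y assume sol: "solution_H \<epsilon> A J t \<sigma> \<nu> x y"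
  define M where "M = (norm (block_vec (x 0) (y 0)))\<^sup>2"
  have lim: "(\<lambda>k. C * \<theta> ^ k * M) \<longlonglongrightarrow> C * 0 * M"
    using \<theta> by (intro tendsto_intros LIMSEQ_power_zero) auto
  have "((\<lambda>s. (norm (block_vec (x s) (y s)))\<^sup>2) \<longlongrightarrow> 0) at_top"
  proof (rule order_tendstoI)
    fix r :: real assume "0 < r"
    then have "\<forall>\<^sub>F k in sequentially. C * \<theta> ^ k * M < r" using order_tendstoD(2)[OF lim] by simp
    then obtain N where N: "\<And>k. N \<le> k \<Longrightarrow> C * \<theta> ^ k * M < r"
      by (auto simp: eventually_sequentially)
    have "(norm (block_vec (x s) (y s)))\<^sup>2 < r" if "s \<ge> t N" for s
    proof -
      have "0 \<le> s" using that t strict_mono_less_eq[of t 0 N] by (auto simp: event_times_def)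
      then obtain k where k: "t k \<le> s" "s < t (Suc k)" using event_times_cases[OF t] by blast
      then have "t N < t (Suc k)" using that by simp
      then have "N \<le> k" using t by (auto simp: event_times_def strict_mono_less)
      then show ?thesis using bound[OF sol k] N[of k] by (simp add: M_def)
    qed
    then show "\<forall>\<^sub>F s in at_top. (norm (block_vec (x s) (y s)))\<^sup>2 < r"
      by (auto simp: eventually_at_top_linorder)
  next
    fix r :: real assume "r < 0"
    then show "\<forall>\<^sub>F s in at_top. r < (norm (block_vec (x s) (y s)))\<^sup>2"
      by (intro always_eventually allI less_le_trans[OF _ zero_le_power2])
  qed
  then have "((\<lambda>s. sqrt ((norm (block_vec (x s) (y s)))\<^sup>2)) \<longlongrightarrow> sqrt 0) at_top"
    by (rule tendsto_real_sqrt)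
  then show "((\<lambda>s. block_vec (x s) (y s)) \<longlongrightarrow> 0) at_top"
    by (simp add: tendsto_norm_zero_iff)
qed

section \<open>The Lyapunov function of the hybrid system, with constants common to all
  modes\<close>

lemma lyapunov_form:
  assumes "symmetric_mat Q" and "loewner_le (transpose F ** Q + Q ** F) ((- 2 * l) *\<^sub>R Q)"
  shows "v \<bullet> (Q *v (F *v v)) \<le> - l * (v \<bullet> (Q *v v))"
proof -
  have "0 \<le> v \<bullet> (((- 2 * l) *\<^sub>R Q - (transpose F ** Q + Q ** F)) *v v)"
    using assms(2) by (simp add: loewner_le_def psd_def)
  also have "\<dots> = - 2 * l * (v \<bullet> (Q *v v)) - v \<bullet> (transpose F *v (Q *v v)) - v \<bullet> (Q *v (F *v v))"
    unfolding matrix_vector_mult_diff_rdistrib matrix_vector_mult_add_rdistrib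
      scaleR_matrix_vector_assoc[symmetric]
    by (simp add: inner_diff_right inner_add_right matrix_vector_mul_assoc)
  \<comment> \<open>By symmetry of \<open>Q\<close> both products contribute the same number, which
    cancels the factor 2 in the rate.\<close>
  also have "v \<bullet> (transpose F *v (Q *v v)) = v \<bullet> (Q *v (F *v v))"
    by (metis assms(1) dot_lmul_matrix inner_commute symmetric_mat_iff transpose_matrix_vector)
  finally show ?thesis by simp
qed

text \<open>Gathers the inequalities on which the stability argument rests, with one rate
  \<open>l\<close> and one bound \<open>c\<close>. The two conditions in \<open>jump_slow\<close>
  are what \<open>\<gamma>\<^sub>1\<^sub>1 = 1\<close> and
  \<open>\<gamma>\<^sub>1\<^sub>2 = 0\<close> amount to.\<close>

locale hybrid_bounds =
  fixes A :: "'i::finite \<Rightarrow> real ^ ('x::finite + 'z::finite) ^ ('x + 'z)"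
    and J :: "'i \<Rightarrow> 'j::finite \<Rightarrow> 'i \<Rightarrow> real ^ ('x + 'z) ^ ('x + 'z)"
    and Qs :: "'i \<Rightarrow> real ^ 'x ^ 'x" and Qf :: "'i \<Rightarrow> real ^ 'z ^ 'z"
    and l c :: real
  assumes sym: "symmetric_mat (Qs i)" "symmetric_mat (Qf i)"
    and ge: "loewner_le (mat 1) (Qs i)" "loewner_le (mat 1) (Qf i)"
    and l_pos: "0 < l" and c_ge: "1 \<le> c"
    and lyap: "v \<bullet> (Qs i *v (slow_A0 (A i) *v v)) \<le> - l * (v \<bullet> (Qs i *v v))"
      "w \<bullet> (Qf i *v (block22 (A i) *v w)) \<le> - l * (w \<bullet> (Qf i *v w))"
    and flow_bounds: "norm (Qs i *v (B1 (A i) *v w)) \<le> c * norm w"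
      "norm (Qf i *v (B2 (A i) *v v)) \<le> c * norm v"
      "norm (Qf i *v (B3 (A i) *v w)) \<le> c * norm w"
    and weight_bounds: "norm (Qs i *v v) \<le> c * norm v" "norm (Qf i *v w) \<le> c * norm w"
    and jump_slow: "(block11 (jump_R A J i j i') *v v) \<bullet> (Qs i' *v (block11 (jump_R A J i j i') *v v))
      \<le> v \<bullet> (Qs i *v v)" "block12 (jump_R A J i j i') *v w = 0"
    and jump_fast: "norm (block21 (jump_R A J i j i') *v v) \<le> c * norm v"
      "norm (block22 (jump_R A J i j i') *v w) \<le> c * norm w"
begin

abbreviation ps where "ps i v \<equiv> v \<bullet> (Qs i *v v)"
abbreviation pf where "pf i w \<equiv> w \<bullet> (Qf i *v w)"

text \<open>One factor \<open>c\<close> comes from \<open>pf_le\<close>, two from squaring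
  \<open>jump_fast\<close>, and the 2 from (a + b)^2 <= 2 (a^2 + b^2).\<close>

definition "g = 2 * c ^ 3"
text \<open>The summand 1 secures \<open>\<kappa>\<close> >= 1, so a dwell time above
  \<open>\<kappa> * g / l * \<epsilon>\<close> also exceeds the \<open>g * \<epsilon> / l\<close>
  that the growth of the weight requires.\<close>

definition "\<kappa> = 8 * c\<^sup>2 / l\<^sup>2 + 1"
definition "\<epsilon>max = min (1 / 2) (min (l / (12 * c)) (l / (2 * \<kappa> * (g + 1) * c)))"

lemma g_pos: "0 < g" and \<kappa>_ge: "1 \<le> \<kappa>" and \<epsilon>max_pos: "0 < \<epsilon>max"
proof -
  show "0 < g" "1 \<le> \<kappa>" using c_ge by (simp_all add: g_def \<kappa>_def)
  then show "0 < \<epsilon>max" using c_ge l_pos by (simp add: \<epsilon>max_def)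
qed

lemma small_\<epsilon>:
  assumes "\<epsilon> < \<epsilon>max"
  shows "2 * \<kappa> * (g + 1) * c * \<epsilon> \<le> l" "12 * c * \<epsilon> \<le> l" "2 * \<epsilon> \<le> 1"
proof -
  have "0 < 2 * \<kappa> * (g + 1) * c" using c_ge g_pos \<kappa>_ge by simp
  then show "2 * \<kappa> * (g + 1) * c * \<epsilon> \<le> l"
    using assms by (simp add: \<epsilon>max_def pos_less_divide_eq mult.commute)
  show "12 * c * \<epsilon> \<le> l" "2 * \<epsilon> \<le> 1"
    using assms c_ge by (simp_all add: \<epsilon>max_def pos_less_divide_eq mult.commute)
qed

lemma ps_nonneg: "0 \<le> ps i v" and pf_nonneg: "0 \<le> pf i w"
  by (rule order_trans[OF zero_le_power2 norm_le_quadratic_form[OF ge(1)]],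
      rule order_trans[OF zero_le_power2 norm_le_quadratic_form[OF ge(2)]])

lemma ps_le: "ps i v \<le> c * (norm v)\<^sup>2" and pf_le: "pf i w \<le> c * (norm w)\<^sup>2"
proof -
  have "u \<bullet> (M *v u) \<le> c * (norm u)\<^sup>2" if "norm (M *v u) \<le> c * norm u"
    for u :: "real ^ 'k" and M
  proof -
    have "u \<bullet> (M *v u) \<le> norm u * norm (M *v u)" by (rule norm_cauchy_schwarz)
    also have "\<dots> \<le> norm u * (c * norm u)" using that by (intro mult_left_mono) auto
    finally show ?thesis by (simp add: power2_eq_square algebra_simps)
  qed
  then show "ps i v \<le> c * (norm v)\<^sup>2" "pf i w \<le> c * (norm w)\<^sup>2" using weight_bounds by blast+
qed

text \<open>With a = \<open>\<epsilon> * \<kappa>\<close>, the new fast energy costs at most a g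
  times the sum of both old forms. The fast share is covered by the weight \<open>g + 1\<close>; the
  slow share is a fraction a g of the old slow form.\<close>

lemma jump_growth:
  assumes \<epsilon>: "0 < \<epsilon>"
    and jump: "block_vec x' y' = jump_R A J i j i' *v block_vec x y"
  shows "ps i' x' + \<epsilon> * \<kappa> * pf i' y' \<le> exp (\<epsilon> * \<kappa> * g) * (ps i x + \<epsilon> * \<kappa> * (g + 1) * pf i y)"
proof -
  let ?R = "jump_R A J i j i'"
  have x': "x' = block11 ?R *v x" and y': "y' = block21 ?R *v x + block22 ?R *v y"
    using jump unfolding matrix_vector_mult_block_vec block_vec_eq_iff by (simp_all add: jump_slow)
  have a: "0 < \<epsilon> * \<kappa>" using \<epsilon> \<kappa>_ge by simp
  have "norm y' \<le> c * (norm x + norm y)"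
    unfolding y' distrib_left by (intro norm_triangle_mono jump_fast)
  then have "(norm y')\<^sup>2 \<le> (c * (norm x + norm y))\<^sup>2" by (intro power_mono) auto
  also have "\<dots> \<le> c\<^sup>2 * (2 * ((norm x)\<^sup>2 + (norm y)\<^sup>2))"
    unfolding power_mult_distrib
    using sum_squares_bound[of "norm x" "norm y"] by (intro mult_left_mono) (auto simp: power2_sum)
  also have "\<dots> \<le> c\<^sup>2 * (2 * (ps i x + pf i y))"
    using norm_le_quadratic_form[OF ge(1), of x i] norm_le_quadratic_form[OF ge(2), of y i]
    by (intro mult_left_mono) auto
  finally have "c * (norm y')\<^sup>2 \<le> c * (c\<^sup>2 * (2 * (ps i x + pf i y)))"
    using c_ge by (intro mult_left_mono) auto
  then have "pf i' y' \<le> g * (ps i x + pf i y)"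
    using pf_le[of y' i'] by (simp add: g_def power3_eq_cube power2_eq_square algebra_simps)
  then have "\<epsilon> * \<kappa> * pf i' y' \<le> \<epsilon> * \<kappa> * (g * (ps i x + pf i y))"
    using a by (intro mult_left_mono) auto
  moreover have "ps i' x' \<le> ps i x" unfolding x' by (rule jump_slow)
  moreover have "0 \<le> \<epsilon> * \<kappa> * pf i y" "0 \<le> \<epsilon> * \<kappa> * g * (\<epsilon> * \<kappa> * (g + 1) * pf i y)"
    using a g_pos pf_nonneg by simp_all
  ultimately have "ps i' x' + \<epsilon> * \<kappa> * pf i' y'
      \<le> (1 + \<epsilon> * \<kappa> * g) * (ps i x + \<epsilon> * \<kappa> * (g + 1) * pf i y)"
    by (simp add: algebra_simps)
  also have "\<dots> \<le> exp (\<epsilon> * \<kappa> * g) * (ps i x + \<epsilon> * \<kappa> * (g + 1) * pf i y)"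
    using a g_pos ps_nonneg pf_nonneg by (intro mult_right_mono exp_ge_add_one_self) simp
  finally show ?thesis .
qed

lemma stable:
  assumes \<epsilon>: "0 < \<epsilon>" "\<epsilon> < \<epsilon>max"
    and t: "event_times t"
    and dwell: "\<kappa> * g / l * \<epsilon> < \<tau>" "\<And>k. \<tau> \<le> t (Suc k) - t k"
  shows "globally_asymptotically_stable_H \<epsilon> A J t \<sigma> \<nu>"
proof -
  \<comment> \<open>A jump contributes at most exp(\<open>\<epsilon> * \<kappa> * g\<close>) and an
    interval at most exp(-\<open>l * \<tau>\<close>); the dwell-time bound says that the combined
    exponent is negative.\<close>
  define \<theta> where "\<theta> = exp (\<epsilon> * \<kappa> * g - l * \<tau>)"
  have a: "0 < \<epsilon> * \<kappa>" using \<epsilon> \<kappa>_ge by simp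
  \<comment> \<open>\<open>\<mu>\<close> bounds the energy from below by the squared norm, and
    \<open>c * (1 + \<epsilon> * \<kappa>)\<close> from above at time 0. Their dependence on
    \<open>\<epsilon>\<close> is harmless, since stability is claimed for each fixed
    \<open>\<epsilon>\<close>.\<close>
  define \<mu> where "\<mu> = min 1 (\<epsilon> * \<kappa>)"
  have \<mu>: "0 < \<mu>" "\<mu> \<le> 1" "\<mu> \<le> \<epsilon> * \<kappa>" using a by (auto simp: \<mu>_def)
  define C where "C = c * (1 + \<epsilon> * \<kappa>) / \<mu>"
  have C: "0 < C" using a \<mu> c_ge by (simp add: C_def)
  have \<tau>: "0 < \<tau>"
    using dwell(1) \<epsilon> \<kappa>_ge g_pos l_pos by (smt (verit) divide_nonneg_pos mult_nonneg_nonneg)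
  have ab: "t k < t (Suc k)" for k using dwell(2)[of k] \<tau> by simp
  have t0: "t 0 = 0" using t by (simp add: event_times_def)
  have \<tau>_small: "\<epsilon> * (g / (t (Suc k) - t k)) \<le> l" for k
  proof -
    have "g * \<epsilon> / l \<le> \<kappa> * (g * \<epsilon> / l)"
      using mult_right_mono[OF \<kappa>_ge, of "g * \<epsilon> / l"] \<epsilon> g_pos l_pos by simp
    then have "g * \<epsilon> / l \<le> t (Suc k) - t k" using dwell(1) dwell(2)[of k] by (simp add: algebra_simps)
    then show ?thesis using l_pos ab[of k] by (simp add: field_simps)
  qed
  show ?thesis
  proof (rule globally_asymptotically_stable_HI[OF t _ _ C, of \<theta>])
    show "0 \<le> \<theta>" by (simp add: \<theta>_def)
    show "\<theta> < 1" using dwell(1) l_pos by (simp add: \<theta>_def field_simps)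
    fix x y k s assume sol: "solution_H \<epsilon> A J t \<sigma> \<nu> x y" and s: "t k \<le> s" "s < t (Suc k)"
    define V where "V = (\<lambda>k. ps (\<sigma> k) (x (t k)) + \<epsilon> * \<kappa> * pf (\<sigma> k) (y (t k)))"
    \<comment> \<open>\<open>U k\<close> interpolates: it equals \<open>V k\<close> at
      \<open>t k\<close>, and its weight tends to \<open>g + 1\<close> at the next event, the form
      that \<open>jump_growth\<close> takes.\<close>
    define U where "U = (\<lambda>k s. ps (\<sigma> k) (x s) +
        \<epsilon> * \<kappa> * (1 + g * (s - t k) / (t (Suc k) - t k)) * pf (\<sigma> k) (y s))"
    have V_nonneg: "0 \<le> V k" for k using a ps_nonneg pf_nonneg by (simp add: V_def)
    have flow: "U k s \<le> exp (- l * (s - t k)) * V k" if "s \<in> {t k..<t (Suc k)}" for k s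
      unfolding U_def V_def
    proof (rule flow_decay[OF sym ge lyap flow_bounds l_pos c_ge \<epsilon>(1) g_pos ab _ small_\<epsilon>[OF \<epsilon>(2)] \<tau>_small _ that])
      show "8 * c\<^sup>2 / l\<^sup>2 \<le> \<kappa>" by (simp add: \<kappa>_def)
    qed (use sol in \<open>simp add: solution_H_def\<close>)
    have step: "V (Suc k) \<le> \<theta> * V k" for k
    proof -
      have "\<exists>xl yl. (x \<longlongrightarrow> xl) (at_left (t (Suc k))) \<and> (y \<longlongrightarrow> yl) (at_left (t (Suc k))) \<and>
        block_vec (x (t (Suc k))) (y (t (Suc k))) =
          jump_R A J (\<sigma> k) (\<nu> (Suc k)) (\<sigma> (Suc k)) *v block_vec xl yl"
        using sol unfolding solution_H_def by (metis diff_Suc_1 le_add1 plus_1_eq_Suc)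
      then obtain xl yl where lim: "(x \<longlongrightarrow> xl) (at_left (t (Suc k)))" "(y \<longlongrightarrow> yl) (at_left (t (Suc k)))"
        and jump: "block_vec (x (t (Suc k))) (y (t (Suc k))) =
          jump_R A J (\<sigma> k) (\<nu> (Suc k)) (\<sigma> (Suc k)) *v block_vec xl yl" by blast
      \<comment> \<open>The flow estimate holds on the half-open interval only, and the value at
        \<open>t (Suc k)\<close> is already the state after the jump; so the estimate is carried to
        the left limits.\<close>
      have "((\<lambda>s. U k s) \<longlongrightarrow> ps (\<sigma> k) xl +
          \<epsilon> * \<kappa> * (1 + g * (t (Suc k) - t k) / (t (Suc k) - t k)) * pf (\<sigma> k) yl) (at_left (t (Suc k)))"
        unfolding U_def using ab[of k]
        by (intro tendsto_intros lim bounded_linear.tendsto[OF matrix_vector_mul_bounded_linear]) auto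
      moreover have "((\<lambda>s. exp (- l * (s - t k)) * V k) \<longlongrightarrow>
          exp (- l * (t (Suc k) - t k)) * V k) (at_left (t (Suc k)))"
        by (intro tendsto_intros)
      moreover have "\<forall>\<^sub>F s in at_left (t (Suc k)). U k s \<le> exp (- l * (s - t k)) * V k"
        using flow ab[of k] by (intro eventually_at_leftI[of "t k"]) auto
      ultimately have "ps (\<sigma> k) xl + \<epsilon> * \<kappa> * (1 + g * (t (Suc k) - t k) / (t (Suc k) - t k)) * pf (\<sigma> k) yl
          \<le> exp (- l * (t (Suc k) - t k)) * V k"
        by (intro tendsto_le[OF trivial_limit_at_left_real])
      also have "\<dots> \<le> exp (- l * \<tau>) * V k"
        using dwell(2)[of k] l_pos V_nonneg by (intro mult_right_mono) auto
      finally have "ps (\<sigma> k) xl + \<epsilon> * \<kappa> * (g + 1) * pf (\<sigma> k) yl \<le> exp (- l * \<tau>) * V k"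
        using ab[of k] by (simp add: add.commute)
      then have "exp (\<epsilon> * \<kappa> * g) * (ps (\<sigma> k) xl + \<epsilon> * \<kappa> * (g + 1) * pf (\<sigma> k) yl)
          \<le> exp (\<epsilon> * \<kappa> * g) * (exp (- l * \<tau>) * V k)"
        by (intro mult_left_mono) auto
      also have "\<dots> = \<theta> * V k" by (simp add: \<theta>_def exp_diff exp_minus field_simps)
      finally show ?thesis using jump_growth[OF \<epsilon>(1) jump] by (simp add: V_def)
    qed
    have V_power: "V k \<le> \<theta> ^ k * V 0" for k
    proof (induction k)
      case (Suc k)
      have "\<theta> * V k \<le> \<theta> * (\<theta> ^ k * V 0)" using Suc by (intro mult_left_mono) (auto simp: \<theta>_def)
      then show ?case using step[of k] by (simp add: algebra_simps)
    qed simp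
    have "\<mu> * (norm (block_vec (x s) (y s)))\<^sup>2 \<le> U k s"
    proof -
      have "\<mu> * (norm (x s))\<^sup>2 \<le> 1 * ps (\<sigma> k) (x s)"
        using \<mu> norm_le_quadratic_form[OF ge(1)] by (intro mult_mono) auto
      moreover have "\<mu> * (norm (y s))\<^sup>2 \<le> \<epsilon> * \<kappa> * pf (\<sigma> k) (y s)"
        using \<mu> a norm_le_quadratic_form[OF ge(2)] by (intro mult_mono) auto
      moreover have "\<epsilon> * \<kappa> * 1 * pf (\<sigma> k) (y s)
          \<le> \<epsilon> * \<kappa> * (1 + g * (s - t k) / (t (Suc k) - t k)) * pf (\<sigma> k) (y s)"
        using a s g_pos pf_nonneg by (intro mult_right_mono mult_left_mono) auto
      ultimately show ?thesis by (simp add: U_def norm_block_vec distrib_left)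
    qed
    also have "\<dots> \<le> exp (- l * (s - t k)) * V k" using flow s by simp
    also have "\<dots> \<le> 1 * V k" using l_pos s V_nonneg by (intro mult_right_mono) auto
    also have "\<dots> \<le> \<theta> ^ k * V 0" using V_power by simp
    also have "\<dots> \<le> \<theta> ^ k * (c * (1 + \<epsilon> * \<kappa>) * (norm (block_vec (x 0) (y 0)))\<^sup>2)"
    proof (rule mult_left_mono)
      have "\<epsilon> * \<kappa> * pf (\<sigma> 0) (y 0) \<le> \<epsilon> * \<kappa> * (c * (norm (y 0))\<^sup>2)"
        using a pf_le by (intro mult_left_mono) auto
      moreover have "0 \<le> c * (norm (y 0))\<^sup>2" "0 \<le> \<epsilon> * \<kappa> * (c * (norm (x 0))\<^sup>2)" using a c_ge by simp_all
      ultimately show "V 0 \<le> c * (1 + \<epsilon> * \<kappa>) * (norm (block_vec (x 0) (y 0)))\<^sup>2"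
        using ps_le[of "x 0" "\<sigma> 0"] by (simp add: V_def t0 norm_block_vec algebra_simps)
    qed (simp add: \<theta>_def)
    finally show "(norm (block_vec (x s) (y s)))\<^sup>2 \<le> C * \<theta> ^ k * (norm (block_vec (x 0) (y 0)))\<^sup>2"
      using \<mu> by (simp add: C_def field_simps)
  qed
qed

end

section \<open>Uniform constants and the dwell-time threshold\<close>

theorem theorem10:
  fixes Z :: "'i::finite \<Rightarrow> ('x::finite + 'z::finite) set"
    and S :: "'i \<Rightarrow> real ^ ('x + 'z) ^ ('x + 'z)"
    and bA :: "'i \<Rightarrow> real ^ ('x + 'z) ^ ('x + 'z)"
    and bJ :: "'j::finite \<Rightarrow> real ^ ('x + 'z) ^ ('x + 'z)"
    and A :: "'i \<Rightarrow> real ^ ('x + 'z) ^ ('x + 'z)"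
    and J :: "'i \<Rightarrow> 'j \<Rightarrow> 'i \<Rightarrow> real ^ ('x + 'z) ^ ('x + 'z)"
    and Qs :: "'i \<Rightarrow> real ^ 'x ^ 'x"
    and Qf :: "'i \<Rightarrow> real ^ 'z ^ 'z"
    and ls lf :: "'i \<Rightarrow> real"
  assumes Z_card: "\<And>i. card (Z i) = CARD('z)"
    and S_perm: "\<And>i. permutation_mat (S i)"
    and S_diag: "\<And>i \<epsilon>. \<epsilon> > 0 \<Longrightarrow>
      S i ** eps_diag (Z i) \<epsilon> ** transpose (S i) = block_mat (mat 1) 0 0 (\<epsilon> *\<^sub>R mat 1)"
    and A_eq: "\<And>i. A i = S i ** bA i ** transpose (S i)"
    and J_eq: "\<And>i j i'. J i j i' = S i' ** bJ j ** transpose (S i)"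
    and A22_nonsingular: "\<And>i. invertible (block22 (A i))"
    and A0_hurwitz: "\<And>i. hurwitz (slow_A0 (A i))"
    and A22_hurwitz: "\<And>i. hurwitz (block22 (A i))"
    and Qs_sym: "\<And>i. symmetric_mat (Qs i)"
    and Qs_ge: "\<And>i. loewner_le (mat 1) (Qs i)"
    and Qf_sym: "\<And>i. symmetric_mat (Qf i)"
    and Qf_ge: "\<And>i. loewner_le (mat 1) (Qf i)"
    and ls_pos: "\<And>i. ls i > 0"
    and lf_pos: "\<And>i. lf i > 0"
    and Qs_lyap: "\<And>i. loewner_le
      (transpose (slow_A0 (A i)) ** Qs i + Qs i ** slow_A0 (A i)) ((- 2 * ls i) *\<^sub>R Qs i)"
    and Qf_lyap: "\<And>i. loewner_le
      (transpose (block22 (A i)) ** Qf i + Qf i ** block22 (A i)) ((- 2 * lf i) *\<^sub>R Qf i)"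
    and gamma11: "gamma11 A J Qs = 1"
    and gamma12: "gamma12 A J Qs Qf = 0"
  shows "\<exists>\<epsilon>3 > 0. \<exists>\<eta>3 :: real \<Rightarrow> real.
    (\<forall>\<epsilon>\<in>{0<..<\<epsilon>3}. \<eta>3 \<epsilon> \<ge> 0) \<and> bigo_eps \<eta>3 \<epsilon>3 \<and>
    (\<forall>\<epsilon>\<in>{0<..<\<epsilon>3}. \<forall>t :: nat \<Rightarrow> real.
      event_times t \<and> (\<exists>\<tau>star > \<eta>3 \<epsilon>. \<forall>k. t (Suc k) - t k \<ge> \<tau>star) \<longrightarrow>
      (\<forall>(\<sigma> :: nat \<Rightarrow> 'i) (\<nu> :: nat \<Rightarrow> 'j). globally_asymptotically_stable_H \<epsilon> A J t \<sigma> \<nu>))"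
proof -
  define l where "l = Min (range ls \<union> range lf)"
  have l: "0 < l" unfolding l_def using ls_pos lf_pos by (subst Min_gr_iff) auto
  have l_le: "l \<le> ls i" "l \<le> lf i" for i unfolding l_def by (auto intro!: Min_le)
  let ?R = "\<lambda>(i, j, i'). jump_R A J i j i'"
  obtain c1 where c1: "\<And>i v. norm ((Qs i ** B1 (A i)) *v v) \<le> c1 * norm v"
    using matrices_uniform_bound[of "\<lambda>i. Qs i ** B1 (A i)"] by blast
  obtain c2 where c2: "\<And>i v. norm ((Qf i ** B2 (A i)) *v v) \<le> c2 * norm v"
    using matrices_uniform_bound[of "\<lambda>i. Qf i ** B2 (A i)"] by blast
  obtain c3 where c3: "\<And>i v. norm ((Qf i ** B3 (A i)) *v v) \<le> c3 * norm v"
    using matrices_uniform_bound[of "\<lambda>i. Qf i ** B3 (A i)"] by blast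
  obtain c4 where c4: "\<And>i v. norm (Qs i *v v) \<le> c4 * norm v"
    using matrices_uniform_bound[of Qs] by blast
  obtain c5 where c5: "\<And>i v. norm (Qf i *v v) \<le> c5 * norm v"
    using matrices_uniform_bound[of Qf] by blast
  obtain c6 where c6: "\<And>k v. norm (block21 (?R k) *v v) \<le> c6 * norm v"
    using matrices_uniform_bound[of "\<lambda>k. block21 (?R k)"] by blast
  obtain c7 where c7: "\<And>k v. norm (block22 (?R k) *v v) \<le> c7 * norm v"
    using matrices_uniform_bound[of "\<lambda>k. block22 (?R k)"] by blast
  define c where "c = Max {1, c1, c2, c3, c4, c5, c6, c7}"
  have up: "C * norm v \<le> c * norm v" if "C \<in> {1, c1, c2, c3, c4, c5, c6, c7}"
    for C and v :: "real ^ 'k"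
    unfolding c_def using that by (intro mult_right_mono Max_ge) auto
  \<comment> \<open>The maximum being 1, each jump is nonexpansive from the norm weighted by
    \<open>Qs i\<close> to the one weighted by \<open>Qs i'\<close>.\<close>
  have jump11: "(norm (psd_sqrt (Qs i') *v (block11 (jump_R A J i j i') *v v)))\<^sup>2
      \<le> (norm (psd_sqrt (Qs i) *v v))\<^sup>2" for i j i' v
  proof -
    have "spectral_norm (psd_sqrt (Qs i') ** block11 (jump_R A J i j i') ** matrix_inv (psd_sqrt (Qs i)))
        \<le> gamma11 A J Qs"
      unfolding gamma11_def by (rule Max_ge) (auto intro!: image_eqI[of _ _ "(i, j, i')"])
    then have "norm (psd_sqrt (Qs i') *v (block11 (jump_R A J i j i') *v v)) \<le> 1 * norm (psd_sqrt (Qs i) *v v)"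
      unfolding gamma11
      by (rule order_trans[OF spectral_norm_weighted[OF invertible_psd_sqrt[OF Qs_sym Qs_ge]] mult_right_mono]) simp
    then show ?thesis by (simp add: power_mono)
  qed
  \<comment> \<open>A maximum of 0 annihilates the weighted image; as \<open>Qs i'\<close> dominates
    the identity, the image itself is zero.\<close>
  have jump12: "block12 (jump_R A J i j i') *v w = 0" for i j i' w
  proof -
    have "spectral_norm (psd_sqrt (Qs i') ** block12 (jump_R A J i j i') ** matrix_inv (psd_sqrt (Qf i)))
        \<le> gamma12 A J Qs Qf"
      unfolding gamma12_def by (rule Max_ge) (auto intro!: image_eqI[of _ _ "(i, j, i')"])
    then have "norm (psd_sqrt (Qs i') *v (block12 (jump_R A J i j i') *v w)) \<le> 0 * norm (psd_sqrt (Qf i) *v w)"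
      unfolding gamma12
      by (rule order_trans[OF spectral_norm_weighted[OF invertible_psd_sqrt[OF Qf_sym Qf_ge]] mult_right_mono]) simp
    then have "(norm (psd_sqrt (Qs i') *v (block12 (jump_R A J i j i') *v w)))\<^sup>2 = 0" by simp
    then have "(norm (block12 (jump_R A J i j i') *v w))\<^sup>2 \<le> 0"
      unfolding norm_psd_sqrt[OF Qs_sym Qs_ge] using norm_le_quadratic_form[OF Qs_ge] by metis
    then show ?thesis by simp
  qed
  \<comment> \<open>The quadratic forms are nonnegative, so the individual rates may be lowered to
    the common \<open>l\<close>.\<close>
  have weaken: "v \<bullet> (Q *v (F *v v)) \<le> - l * (v \<bullet> (Q *v v))"
    if "v \<bullet> (Q *v (F *v v)) \<le> - l' * (v \<bullet> (Q *v v))" "l \<le> l'" "loewner_le (mat 1) Q"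
    for v :: "real ^ 'k" and Q F l'
  proof -
    have "0 \<le> v \<bullet> (Q *v v)" using norm_le_quadratic_form[OF that(3)] by (rule order_trans[rotated]) simp
    then have "l * (v \<bullet> (Q *v v)) \<le> l' * (v \<bullet> (Q *v v))" using that(2) by (rule mult_right_mono[rotated])
    then show ?thesis using that(1) by simp
  qed
  interpret hybrid_bounds A J Qs Qf l c
  proof
    show "1 \<le> c" unfolding c_def by (rule Max_ge) auto
    fix i :: 'i and i' :: 'i and j :: 'j and v :: "real ^ 'x" and w :: "real ^ 'z"
    show "v \<bullet> (Qs i *v (slow_A0 (A i) *v v)) \<le> - l * (v \<bullet> (Qs i *v v))"
      by (rule weaken[OF lyapunov_form[OF Qs_sym Qs_lyap] l_le(1) Qs_ge])
    show "w \<bullet> (Qf i *v (block22 (A i) *v w)) \<le> - l * (w \<bullet> (Qf i *v w))"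
      by (rule weaken[OF lyapunov_form[OF Qf_sym Qf_lyap] l_le(2) Qf_ge])
    show "norm (Qs i *v (B1 (A i) *v w)) \<le> c * norm w"
      unfolding matrix_vector_mul_assoc by (rule order_trans[OF c1 up]) simp
    show "norm (Qf i *v (B2 (A i) *v v)) \<le> c * norm v"
      unfolding matrix_vector_mul_assoc by (rule order_trans[OF c2 up]) simp
    show "norm (Qf i *v (B3 (A i) *v w)) \<le> c * norm w"
      unfolding matrix_vector_mul_assoc by (rule order_trans[OF c3 up]) simp
    show "norm (Qs i *v v) \<le> c * norm v" by (rule order_trans[OF c4 up]) simp
    show "norm (Qf i *v w) \<le> c * norm w" by (rule order_trans[OF c5 up]) simp
    show "norm (block21 (jump_R A J i j i') *v v) \<le> c * norm v"
      using order_trans[OF c6[of "(i, j, i')" v] up] by simp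
    show "norm (block22 (jump_R A J i j i') *v w) \<le> c * norm w"
      using order_trans[OF c7[of "(i, j, i')" w] up] by simp
    show "(block11 (jump_R A J i j i') *v v) \<bullet> (Qs i' *v (block11 (jump_R A J i j i') *v v)) \<le> v \<bullet> (Qs i *v v)"
      using jump11[of i' i j v] unfolding norm_psd_sqrt[OF Qs_sym Qs_ge] .
  qed (fact Qs_sym Qf_sym Qs_ge Qf_ge l jump12)+
  \<comment> \<open>The threshold in \<open>stable\<close> is linear in \<open>\<epsilon>\<close>;
    it serves as the function \<open>\<eta>3\<close>.\<close>
  define K where "K = \<kappa> * g / l"
  have K: "0 < K" using \<kappa>_ge g_pos l by (simp add: K_def)
  have "bigo_eps (\<lambda>\<epsilon>. K * \<epsilon>) \<epsilon>max"
    unfolding bigo_eps_def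
  proof (intro bexI exI conjI ballI)
    \<comment> \<open>\<open>bigo_eps\<close> wants its threshold strictly inside the interval,
      hence half of \<open>\<epsilon>max\<close>.\<close>
    fix \<epsilon> :: real assume "\<epsilon> \<in> {0<..<\<epsilon>max / 2}"
    then show "\<bar>K * \<epsilon>\<bar> \<le> K * \<epsilon>" using K by simp
  qed (use K \<epsilon>max_pos in auto)
  then show ?thesis
    using \<epsilon>max_pos K stable[folded K_def]
    by (intro exI[of _ \<epsilon>max] exI[of _ "\<lambda>\<epsilon>. K * \<epsilon>"] conjI ballI allI impI) auto
qed

end
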